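(* Let $A$ be an $n\times n$ irreducible, nonnegative, positive semidefinite matrix and $\mathbf{x}\in\mathbb{R}^n_{++}$. Let $i_1$ be a log-concavity index and $i_2$ a log-convexity index of $A$ associated with $\mathbf{x}$ (such indices exist). Let $g_k=(A^{k-1}\mathbf{x})_{i_1}$ and $h_k=(A^{k-1}\mathbf{x})_{i_2}$ for $k\ge1$. Then $(g_k)_{k\ge k_1}$ is log-concave for some $k_1\ge1$, and $(h_k)_{k\ge k_2}$ is log-convex for some $k_2\ge1$.
   Context: $\mathbb{R}^n_{++}$ is the set of entrywise positive vectors. Irreducible: not permutation-similar to a block upper triangular matrix with at least two diagonal blocks; positive semidefinite: symmetric with nonnegative eigenvalues. An index $i_0$ is a log-concavity (resp. log-convexity) index of $A$ associated with $\mathbf{x}$ if there is $K>0$ such that for all $k\ge K$, $\frac{(A^k\mathbf{x})_{i_0}}{(A^{k-1}\mathbf{x})_{i_0}}=\max_i\frac{(A^k\mathbf{x})_i}{(A^{k-1}\mathbf{x})_i}$ (resp. $=\min_i$). A sequence $(z_m)$ is log-concave (resp. log-convex) if $z_{m-1}z_{m+1}\le z_m^2$ (resp. $\ge$) for every interior index $m$. *)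

theory Defs
  imports Complex_Main "Jordan_Normal_Form.Char_Poly"
begin

definition nonneg_mat :: "real mat \<Rightarrow> bool" where
  "nonneg_mat A \<longleftrightarrow> (\<forall>i<dim_row A. \<forall>j<dim_col A. 0 \<le> A $$ (i, j))"

definition pos_vec :: "real vec \<Rightarrow> bool" where
  "pos_vec x \<longleftrightarrow> (\<forall>i<dim_vec x. 0 < x $ i)"

text \<open>For a symmetric real matrix every complex eigenvalue is real, so quantifying over the
  real eigenvalues covers the whole spectrum.\<close>

definition psd_mat :: "real mat \<Rightarrow> bool" where
  "psd_mat A \<longleftrightarrow>
     square_mat A \<and> transpose_mat A = A \<and> (\<forall>e. eigenvalue A e \<longrightarrow> 0 \<le> e)"

definition perm_mat :: "nat \<Rightarrow> (nat \<Rightarrow> nat) \<Rightarrow> real mat" where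
  "perm_mat n p = mat n n (\<lambda>(i, j). if j = p i then 1 else 0)"

definition perm_similar :: "real mat \<Rightarrow> real mat \<Rightarrow> bool" where
  "perm_similar A B \<longleftrightarrow>
     (\<exists>p. p permutes {..<dim_row A} \<and>
        B = perm_mat (dim_row A) p * A * transpose_mat (perm_mat (dim_row A) p))"

text \<open>A list \<open>ns\<close> of positive block sizes summing to the dimension splits the index range into
  consecutive intervals, the \<open>q\<close>-th one being \<open>block ns q\<close>.\<close>

definition block :: "nat list \<Rightarrow> nat \<Rightarrow> nat set" where
  "block ns q = {sum_list (take q ns)..<sum_list (take (Suc q) ns)}"

definition block_upper_triangular :: "nat list \<Rightarrow> real mat \<Rightarrow> bool" where
  "block_upper_triangular ns B \<longleftrightarrow>
     square_mat B \<and> (\<forall>m\<in>set ns. 0 < m) \<and> sum_list ns = dim_row B \<and>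
     (\<forall>q<length ns. \<forall>p<q. \<forall>i\<in>block ns q. \<forall>j\<in>block ns p. B $$ (i, j) = 0)"

definition irreducible_mat :: "real mat \<Rightarrow> bool" where
  "irreducible_mat A \<longleftrightarrow>
     square_mat A \<and>
     \<not> (\<exists>B ns. perm_similar A B \<and> 2 \<le> length ns \<and> block_upper_triangular ns B)"

text \<open>\<open>growth_ratio A x k i\<close> is only meant for \<open>k \<ge> 1\<close>.  If \<open>A\<close> is irreducible and
  nonnegative and \<open>x\<close> is positive, its denominator can vanish only for the \<open>1 \<times> 1\<close> zero
  matrix, where the ratio is \<open>0\<close> by the convention for division by zero.\<close>

definition growth_ratio :: "real mat \<Rightarrow> real vec \<Rightarrow> nat \<Rightarrow> nat \<Rightarrow> real" where
  "growth_ratio A x k i = ((A ^\<^sub>m k) *\<^sub>v x) $ i / ((A ^\<^sub>m (k - 1)) *\<^sub>v x) $ i"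

definition log_concavity_index :: "real mat \<Rightarrow> real vec \<Rightarrow> nat \<Rightarrow> bool" where
  "log_concavity_index A x i0 \<longleftrightarrow>
     i0 < dim_row A \<and>
     (\<exists>K>0. \<forall>k\<ge>K. growth_ratio A x k i0 = Max (growth_ratio A x k ` {..<dim_row A}))"

definition log_convexity_index :: "real mat \<Rightarrow> real vec \<Rightarrow> nat \<Rightarrow> bool" where
  "log_convexity_index A x i0 \<longleftrightarrow>
     i0 < dim_row A \<and>
     (\<exists>K>0. \<forall>k\<ge>K. growth_ratio A x k i0 = Min (growth_ratio A x k ` {..<dim_row A}))"

text \<open>Log-concavity and log-convexity of the tail \<open>z k0, z (k0 + 1), \<dots>\<close>, whose interior
  indices are the \<open>m > k0\<close>.\<close>

definition log_concave_from :: "nat \<Rightarrow> (nat \<Rightarrow> real) \<Rightarrow> bool" where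
  "log_concave_from k0 z \<longleftrightarrow> (\<forall>m>k0. z (m - 1) * z (m + 1) \<le> (z m)\<^sup>2)"

definition log_convex_from :: "nat \<Rightarrow> (nat \<Rightarrow> real) \<Rightarrow> bool" where
  "log_convex_from k0 z \<longleftrightarrow> (\<forall>m>k0. z (m - 1) * z (m + 1) \<ge> (z m)\<^sup>2)"

end

(* Symmetry makes the roots of a minimal polynomial annihilating the orbit of x real and simple,
   so every coordinate of A^k x is a real combination of powers z^k of nonnegative eigenvalues z.
   Such exponential sums have an eventually constant sign (divide by one of the powers and
   difference, as in Rolle's theorem), hence any two growth ratios are eventually comparable and
   an eventually maximal and an eventually minimal one exist.  If A^k x <= M A^(k-1) x entrywise,
   with equality at the index of maximal ratio, then applying the nonnegative A gives
   A^(k+1) x <= M A^k x, which at that index is log-concavity; the minimum is symmetric. *)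

theory Submission
  imports Defs "HOL-Computational_Algebra.Fundamental_Theorem_Algebra"
begin

section \<open>Eventual sign of exponential sums\<close>

text \<open>One positive value in the monotone range keeps all later values positive; if no such
  value exists, the sequence is eventually at most 0.\<close>

lemma eventually_mono_seq_sign:
  fixes v :: "nat \<Rightarrow> real"
  assumes "\<forall>\<^sub>F k in sequentially. v k \<le> v (Suc k)"
  shows "(\<forall>\<^sub>F k in sequentially. 0 \<le> v k) \<or> (\<forall>\<^sub>F k in sequentially. v k \<le> 0)"
proof (cases "\<forall>\<^sub>F k in sequentially. v k \<le> 0")
  case False
  obtain N where N: "\<And>k. k \<ge> N \<Longrightarrow> v k \<le> v (Suc k)"
    using assms unfolding eventually_sequentially by blast
  obtain m where m: "m \<ge> N" "v m > 0"
    using False unfolding eventually_sequentially by (meson not_le)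
  have "v m \<le> v k" if "k \<ge> m" for k
    using that
  proof (induction k rule: dec_induct)
    case (step k)
    then show ?case using N[of k] m by linarith
  qed simp
  then show ?thesis
    using m unfolding eventually_sequentially by (meson less_le_trans less_imp_le)
qed simp

text \<open>A discrete Rolle argument by induction on the number of terms: dividing by one power
  makes its term constant, differencing removes it, and the sign of the difference gives
  monotonicity of the quotient. The bases may repeat, which the later sums over pairs rely
  on.\<close>

lemma exponential_sum_eventually_signed:
  fixes c b :: "'i \<Rightarrow> real"
  assumes "finite I" "\<And>i. i \<in> I \<Longrightarrow> 0 \<le> b i"
  shows "(\<forall>\<^sub>F k in sequentially. 0 \<le> (\<Sum>i\<in>I. c i * b i ^ k)) \<or>
    (\<forall>\<^sub>F k in sequentially. (\<Sum>i\<in>I. c i * b i ^ k) \<le> 0)"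
  using assms
proof (induction I arbitrary: c rule: finite_induct)
  case (insert i I)
  let ?f = "\<lambda>k. \<Sum>j\<in>insert i I. c j * b j ^ k"
  show ?case
  proof (cases "b i = 0")
    case True
    \<comment> \<open>Since \<open>0 ^ 0 = 1\<close>, the term of \<open>i\<close> disappears only
      from \<open>k = 1\<close> on.\<close>
    have "?f k = (\<Sum>j\<in>I. c j * b j ^ k)" if "k \<ge> 1" for k
      using insert that True by (simp add: power_0_left)
    then have eq: "\<forall>\<^sub>F k in sequentially. ?f k = (\<Sum>j\<in>I. c j * b j ^ k)"
      unfolding eventually_sequentially by blast
    have "(\<forall>\<^sub>F k in sequentially. 0 \<le> ?f k) \<longleftrightarrow>
        (\<forall>\<^sub>F k in sequentially. 0 \<le> (\<Sum>j\<in>I. c j * b j ^ k))"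
      by (rule eventually_subst, rule eventually_mono[OF eq]) (simp only:)
    moreover have "(\<forall>\<^sub>F k in sequentially. ?f k \<le> 0) \<longleftrightarrow>
        (\<forall>\<^sub>F k in sequentially. (\<Sum>j\<in>I. c j * b j ^ k) \<le> 0)"
      by (rule eventually_subst, rule eventually_mono[OF eq]) (simp only:)
    ultimately show ?thesis
      using insert.IH insert.prems by blast
  next
    case False
    then have pos: "b i > 0" using insert.prems by (simp add: less_le)
    define v where "v k = ?f k / b i ^ k" for k
    \<comment> \<open>The term of \<open>i\<close> in \<open>v\<close> is the constant
      \<open>c i\<close> and cancels; every other term picks up the factor
      \<open>b j - b i\<close>.\<close>
    have step: "v (Suc k) - v k = (\<Sum>j\<in>I. (c j * (b j - b i)) * b j ^ k) / b i ^ Suc k" for k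
    proof -
      have "v (Suc k) - v k = (?f (Suc k) - b i * ?f k) / b i ^ Suc k"
        using pos by (simp add: v_def field_simps)
      also have "?f (Suc k) - b i * ?f k = (\<Sum>j\<in>I. (c j * (b j - b i)) * b j ^ k)"
        using insert.hyps
        by (simp add: algebra_simps sum_distrib_left sum_subtractf)
      finally show ?thesis .
    qed
    have sgn_v: "0 \<le> v k \<longleftrightarrow> 0 \<le> ?f k" "v k \<le> 0 \<longleftrightarrow> ?f k \<le> 0" for k
      unfolding v_def using zero_less_power[OF pos, of k]
      by (meson divide_nonneg_pos divide_neg_pos divide_nonpos_pos divide_pos_pos not_le)+
    have "(\<forall>\<^sub>F k in sequentially. 0 \<le> (\<Sum>j\<in>I. (c j * (b j - b i)) * b j ^ k)) \<or>
      (\<forall>\<^sub>F k in sequentially. (\<Sum>j\<in>I. (c j * (b j - b i)) * b j ^ k) \<le> 0)"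
      by (rule insert.IH) (simp add: insert.prems)
    then have "(\<forall>\<^sub>F k in sequentially. v k \<le> v (Suc k)) \<or>
      (\<forall>\<^sub>F k in sequentially. - v k \<le> - v (Suc k))"
    proof
      assume "\<forall>\<^sub>F k in sequentially. 0 \<le> (\<Sum>j\<in>I. (c j * (b j - b i)) * b j ^ k)"
      then have "\<forall>\<^sub>F k in sequentially. v k \<le> v (Suc k)"
      proof eventually_elim
        case (elim k)
        then have "0 \<le> v (Suc k) - v k" unfolding step using pos by simp
        then show ?case by simp
      qed
      then show ?thesis ..
    next
      assume "\<forall>\<^sub>F k in sequentially. (\<Sum>j\<in>I. (c j * (b j - b i)) * b j ^ k) \<le> 0"
      then have "\<forall>\<^sub>F k in sequentially. - v k \<le> - v (Suc k)"
      proof eventually_elim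
        case (elim k)
        then have "v (Suc k) - v k \<le> 0"
          unfolding step using pos by (simp add: divide_le_0_iff)
        then show ?case by simp
      qed
      then show ?thesis ..
    qed
    then have "(\<forall>\<^sub>F k in sequentially. 0 \<le> v k) \<or> (\<forall>\<^sub>F k in sequentially. v k \<le> 0)"
      using eventually_mono_seq_sign[of v] eventually_mono_seq_sign[of "\<lambda>k. - v k"] by auto
    then show ?thesis by (simp only: sgn_v)
  qed
qed simp

section \<open>Polynomials in the shift operator\<close>

text \<open>This is the polynomial \<open>p\<close> in the shift evaluated at \<open>f\<close>; it
  vanishes identically when \<open>f\<close> satisfies the linear recurrence with characteristic
  polynomial \<open>p\<close>.\<close>

definition shift_poly :: "'a::comm_ring_1 poly \<Rightarrow> (nat \<Rightarrow> 'a) \<Rightarrow> nat \<Rightarrow> 'a" where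
  "shift_poly p f k = (\<Sum>j\<le>degree p. coeff p j * f (j + k))"

lemma shift_poly_altdef:
  assumes "degree p \<le> m"
  shows "shift_poly p f k = (\<Sum>j\<le>m. coeff p j * f (j + k))"
  unfolding shift_poly_def using assms
  by (intro sum.mono_neutral_left) (auto simp: coeff_eq_0)

lemma shift_poly_0 [simp]: "shift_poly 0 f k = 0"
  by (simp add: shift_poly_def)

lemma shift_poly_add: "shift_poly (p + q) f k = shift_poly p f k + shift_poly q f k"
proof -
  define m where "m = max (degree p) (degree q)"
  have "degree p \<le> m" "degree q \<le> m" "degree (p + q) \<le> m"
    by (simp_all add: m_def degree_add_le_max)
  then show ?thesis
    by (simp add: shift_poly_altdef[of _ m] algebra_simps sum.distrib)
qed

lemma shift_poly_smult: "shift_poly (Polynomial.smult c p) f k = c * shift_poly p f k"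
  by (simp add: shift_poly_altdef[of _ "degree p"] degree_smult_le sum_distrib_left mult.assoc)

lemma shift_poly_pCons: "shift_poly (pCons a p) f k = a * f k + shift_poly p f (Suc k)"
  by (simp add: shift_poly_altdef[of _ "Suc (degree p)"] degree_pCons_le shift_poly_def
      sum.atMost_Suc_shift del: sum.atMost_Suc)

lemma shift_poly_root_factor:
  "shift_poly ([:-z, 1:] * q) f k = shift_poly q f (Suc k) - z * shift_poly q f k"
proof -
  have "[:-z, 1:] * q = pCons 0 q + Polynomial.smult (-z) q" by simp
  then show ?thesis
    by (simp only: shift_poly_add shift_poly_smult shift_poly_pCons) simp
qed

text \<open>Polynomials in the shift commute: if \<open>[:-z, 1:] * q\<close> annihilates
  \<open>f\<close>, then \<open>q\<close> annihilates the twisted difference of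
  \<open>f\<close>.\<close>

lemma shift_poly_difference:
  "shift_poly q (\<lambda>k. f (Suc k) - z * f k) k = shift_poly q f (Suc k) - z * shift_poly q f k"
  by (simp add: shift_poly_def sum_distrib_left sum_subtractf algebra_simps)

text \<open>Peel off one root \<open>z\<close> with cofactor \<open>q\<close>: the difference
  \<open>f (Suc k) - z * f k\<close> is an exponential sum over the roots of \<open>q\<close> by
  induction, and solving this first-order recurrence adds one multiple of \<open>z ^ k\<close>.
  Simplicity is phrased through cofactors so that it passes to \<open>q\<close>.\<close>

lemma annihilated_by_simple_roots:
  fixes p :: "complex poly"
  assumes "p \<noteq> 0"
    and simple: "\<And>z q. p = [:-z, 1:] * q \<Longrightarrow> poly q z \<noteq> 0"
    and "\<And>k. shift_poly p f k = 0"
  shows "\<exists>c. \<forall>k. f k = (\<Sum>z | poly p z = 0. c z * z ^ k)"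
  using assms
proof (induction "degree p" arbitrary: p f)
  case 0
  then obtain a where "p = [:a:]" "a \<noteq> 0"
    by (metis degree_eq_zeroE pCons_0_0)
  with "0.prems"(3) show ?case by (simp add: shift_poly_pCons)
next
  case (Suc d)
  obtain z where "poly p z = 0"
    using Suc.hyps(2) fundamental_theorem_of_algebra[of p] constant_degree[of p] by auto
  then obtain q where p: "p = [:-z, 1:] * q"
    by (metis dvdE poly_eq_0_iff_dvd)
  have "q \<noteq> 0" using p Suc.prems(1) by auto
  have deg: "d = degree q"
  proof -
    have "degree p = degree [:-z, 1:] + degree q"
      unfolding p by (rule degree_mult_eq) (use \<open>q \<noteq> 0\<close> in auto)
    then show ?thesis using Suc.hyps(2) by simp
  qed
  have nz: "poly q z \<noteq> 0" using Suc.prems(2) p by blast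
  have simple_q: "poly r y \<noteq> 0" if "q = [:-y, 1:] * r" for y r
  proof -
    have "p = [:-y, 1:] * ([:-z, 1:] * r)"
      unfolding p that by (rule mult.left_commute)
    then have "poly ([:-z, 1:] * r) y \<noteq> 0" by (rule Suc.prems(2))
    then show ?thesis by auto
  qed
  have ann_q: "shift_poly q (\<lambda>k. f (Suc k) - z * f k) k = 0" for k
    using Suc.prems(3)[of k] unfolding p shift_poly_root_factor shift_poly_difference .
  obtain c where
    c: "\<And>k. f (Suc k) - z * f k = (\<Sum>y | poly q y = 0. c y * y ^ k)"
    using Suc.hyps(1)[OF deg \<open>q \<noteq> 0\<close> simple_q ann_q] by blast
  \<comment> \<open>Undetermined coefficients: the twisted difference of \<open>d y * y ^ k\<close>
    is \<open>d y * (y - z) * y ^ k\<close>. No root \<open>y\<close> of \<open>q\<close> equals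
    \<open>z\<close>, because \<open>z\<close> is a simple root of \<open>p\<close>.\<close>
  define d where "d y = c y / (y - z)" for y
  have d: "d y * (y - z) = c y" if "poly q y = 0" for y
    using that nz by (auto simp: d_def)
  \<comment> \<open>Subtracting the particular solution leaves a solution of the homogeneous
    recurrence, hence a geometric sequence.\<close>
  define h where "h k = f k - (\<Sum>y | poly q y = 0. d y * y ^ k)" for k
  have "h (Suc k) = z * h k" for k
  proof -
    have "(\<Sum>y | poly q y = 0. d y * y ^ Suc k) - z * (\<Sum>y | poly q y = 0. d y * y ^ k) =
        (\<Sum>y | poly q y = 0. d y * (y - z) * y ^ k)"
      by (simp add: sum_distrib_left sum_subtractf algebra_simps)
    also have "\<dots> = (\<Sum>y | poly q y = 0. c y * y ^ k)"
      by (intro sum.cong) (simp_all add: d)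
    finally show ?thesis
      using c[of k] by (simp add: h_def algebra_simps)
  qed
  then have h: "h k = h 0 * z ^ k" for k
    by (induction k) simp_all
  have roots: "{y. poly p y = 0} = insert z {y. poly q y = 0}"
    unfolding p by auto
  have f: "f k = (\<Sum>y | poly p y = 0. (if y = z then h 0 else d y) * y ^ k)" for k
  proof -
    have "(\<Sum>y | poly q y = 0. (if y = z then h 0 else d y) * y ^ k) =
      (\<Sum>y | poly q y = 0. d y * y ^ k)"
      using nz by (intro sum.cong) auto
    then show ?thesis
      using h[of k] nz poly_roots_finite[OF \<open>q \<noteq> 0\<close>] by (simp add: roots h_def diff_eq_eq)
  qed
  show ?case by (intro exI[of _ "\<lambda>y. if y = z then h 0 else d y"] allI f)
qed

section \<open>Orbits of a symmetric matrix\<close>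

text \<open>The coordinate sequences \<open>s i\<close> of an orbit \<open>v, A v, A\<^sup>2 v, \<dots>\<close>; polynomials in the
  shift then act on orbits as polynomials in \<open>A\<close>.\<close>

definition orbit :: "nat \<Rightarrow> (nat \<Rightarrow> nat \<Rightarrow> 'a::comm_ring_1) \<Rightarrow> (nat \<Rightarrow> nat \<Rightarrow> 'a) \<Rightarrow> bool" where
  "orbit n a s \<longleftrightarrow> (\<forall>i<n. \<forall>k. s i (Suc k) = (\<Sum>j<n. a i j * s j k))"

lemma orbit_Suc: "orbit n a s \<Longrightarrow> i < n \<Longrightarrow> s i (Suc k) = (\<Sum>j<n. a i j * s j k)"
  by (simp add: orbit_def)

text \<open>The entries \<open>a i j\<close> do not depend on time, so the shift commutes with the
  matrix; the result is the orbit of p(A)v.\<close>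

lemma orbit_shift_poly:
  assumes "orbit n a s"
  shows "orbit n a (\<lambda>i. shift_poly p (s i))"
  unfolding orbit_def
proof (intro allI impI)
  fix i k assume "i < n"
  have "shift_poly p (s i) (Suc k) = (\<Sum>l\<le>degree p. coeff p l * (\<Sum>j<n. a i j * s j (l + k)))"
    using orbit_Suc[OF assms \<open>i < n\<close>] by (simp add: shift_poly_def)
  also have "\<dots> = (\<Sum>l\<le>degree p. \<Sum>j<n. a i j * (coeff p l * s j (l + k)))"
    by (simp add: sum_distrib_left mult.left_commute)
  also have "\<dots> = (\<Sum>j<n. \<Sum>l\<le>degree p. a i j * (coeff p l * s j (l + k)))"
    by (rule sum.swap)
  also have "\<dots> = (\<Sum>j<n. a i j * shift_poly p (s j) k)"
    by (simp add: shift_poly_def sum_distrib_left)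
  finally show "shift_poly p (s i) (Suc k) = (\<Sum>j<n. a i j * shift_poly p (s j) k)" .
qed

lemma orbit_eq_0:
  assumes "orbit n a s" "\<And>i. i < n \<Longrightarrow> s i 0 = 0" "i < n"
  shows "s i k = 0"
  using assms(3)
proof (induction k arbitrary: i)
  case (Suc k)
  then show ?case using orbit_Suc[OF assms(1)] by simp
qed (use assms(2) in simp)

text \<open>The vectors \<open>v, A v, \<dots>, A\<^sup>n v\<close> are the columns of the matrix \<open>M\<close>, whose last row is padded
  with zeros; a kernel vector lists the coefficients of the polynomial.\<close>

lemma orbit_annihilating_poly:
  fixes s :: "nat \<Rightarrow> nat \<Rightarrow> 'a::field"
  assumes "orbit n a s"
  obtains p where "p \<noteq> 0" "\<And>i k. i < n \<Longrightarrow> shift_poly p (s i) k = 0"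
proof -
  define M where "M = mat (Suc n) (Suc n) (\<lambda>(i, k). if i < n then s i k else 0)"
  have M: "M \<in> carrier_mat (Suc n) (Suc n)" by (simp add: M_def)
  \<comment> \<open>The padding makes \<open>M\<close> square, and its zero row makes the
    determinant vanish, which yields the kernel vector.\<close>
  have "M = mat\<^sub>r (Suc n) (Suc n) (\<lambda>i. if i = n then 0\<^sub>v (Suc n) else row M i)"
    by (rule eq_matI) (auto simp: M_def)
  also have "det \<dots> = 0"
    by (rule det_row_0) (auto simp: M_def)
  finally obtain v where v: "v \<in> carrier_vec (Suc n)" "v \<noteq> 0\<^sub>v (Suc n)" "M *\<^sub>v v = 0\<^sub>v (Suc n)"
    unfolding det_0_iff_vec_prod_zero[OF M] by blast
  define p where "p = Poly (list_of_vec v)"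
  have coeff_p: "coeff p k = v $ k" if "k \<le> n" for k
    using that v(1) by (simp add: p_def nth_default_def list_of_vec_index)
  have deg: "degree p \<le> n"
    using v(1) by (intro degree_le) (simp add: p_def nth_default_def)
  have "p \<noteq> 0"
  proof
    assume "p = 0"
    then have "v $ k = 0" if "k < Suc n" for k
      using coeff_p[of k] that by simp
    then show False using v(1,2) by (metis carrier_vecD eq_vecI index_zero_vec)
  qed
  moreover have "shift_poly p (s i) k = 0" if "i < n" for i k
  \<comment> \<open>An orbit is zero once its starting vector is, so the recurrence need only be
    checked at time 0.\<close>
  proof (rule orbit_eq_0[OF orbit_shift_poly[OF assms]])
    fix i assume "i < n"
    have "(M *\<^sub>v v) $ i = (\<Sum>k\<le>n. s i k * v $ k)"
      using \<open>i < n\<close> v(1)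
      by (simp add: M_def scalar_prod_def lessThan_atLeast0 flip: lessThan_Suc_atMost)
    then show "shift_poly p (s i) 0 = 0"
      using v(3) \<open>i < n\<close> coeff_p by (simp add: shift_poly_altdef[OF deg] mult.commute)
  qed (rule that)
  ultimately show thesis by (rule that)
qed

section \<open>Spectral properties of real symmetric matrices\<close>

lemma sum_symmetric_form:
  fixes u v :: "nat \<Rightarrow> 'a::comm_ring_1"
  assumes "\<And>i j. i < n \<Longrightarrow> j < n \<Longrightarrow> a i j = a j i"
  shows "(\<Sum>i<n. u i * (\<Sum>j<n. a i j * v j)) = (\<Sum>i<n. v i * (\<Sum>j<n. a i j * u j))"
proof -
  have "(\<Sum>i<n. u i * (\<Sum>j<n. a i j * v j)) = (\<Sum>i<n. \<Sum>j<n. u i * a i j * v j)"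
    by (simp add: sum_distrib_left mult.assoc)
  also have "\<dots> = (\<Sum>j<n. \<Sum>i<n. u i * a i j * v j)"
    by (rule sum.swap)
  also have "\<dots> = (\<Sum>j<n. \<Sum>i<n. v j * (a j i * u i))"
    using assms by (intro sum.cong refl) (simp add: mult_ac)
  finally show ?thesis by (simp add: sum_distrib_left)
qed

lemma sum_cnj_mult_eq_0_iff:
  fixes v :: "nat \<Rightarrow> complex"
  shows "(\<Sum>i<n. cnj (v i) * v i) = 0 \<longleftrightarrow> (\<forall>i<n. v i = 0)"
proof -
  have "(\<Sum>i<n. cnj (v i) * v i) = of_real (\<Sum>i<n. (cmod (v i))\<^sup>2)"
    by (simp add: mult.commute flip: complex_norm_square)
  then show ?thesis
    by (simp only: of_real_eq_0_iff) (auto simp: sum_nonneg_eq_0_iff)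
qed

text \<open>Conjugation keeps the real entries, so the conjugate of \<open>v\<close> has eigenvalue
  \<open>cnj z\<close>. Evaluating the Hermitian form of \<open>v\<close> both ways gives
  \<open>z\<close> and \<open>cnj z\<close> times its squared norm.\<close>

lemma real_symmetric_eigenvalue_real:
  fixes a :: "nat \<Rightarrow> nat \<Rightarrow> real" and v :: "nat \<Rightarrow> complex"
  assumes sym: "\<And>i j. i < n \<Longrightarrow> j < n \<Longrightarrow> a i j = a j i"
    and ev: "\<And>i. i < n \<Longrightarrow> (\<Sum>j<n. of_real (a i j) * v j) = z * v i"
    and nz: "i < n" "v i \<noteq> 0"
  shows "z \<in> \<real>"
proof -
  have ev': "(\<Sum>j<n. of_real (a i j) * cnj (v j)) = cnj z * cnj (v i)" if "i < n" for i
    using arg_cong[OF ev[OF that], of cnj] by simp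
  have "z * (\<Sum>i<n. cnj (v i) * v i) = (\<Sum>i<n. cnj (v i) * (\<Sum>j<n. of_real (a i j) * v j))"
    by (simp add: ev) (simp add: sum_distrib_left mult_ac)
  also have "\<dots> = (\<Sum>i<n. v i * (\<Sum>j<n. of_real (a i j) * cnj (v j)))"
    using sym by (intro sum_symmetric_form) simp
  also have "\<dots> = cnj z * (\<Sum>i<n. cnj (v i) * v i)"
    by (simp add: ev') (simp add: sum_distrib_left mult_ac)
  finally have "z = cnj z"
    using nz by (auto simp: sum_cnj_mult_eq_0_iff)
  then show ?thesis by (simp add: Reals_cnj_iff)
qed

text \<open>Here \<open>t\<close> lies in both the image and the kernel of A - z, which are
  orthogonal for symmetric A and real \<open>z\<close>; thus \<open>t\<close> is orthogonal to
  itself. This excludes nontrivial Jordan blocks.\<close>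

lemma real_symmetric_no_nilpotent_part:
  fixes a :: "nat \<Rightarrow> nat \<Rightarrow> real" and v :: "nat \<Rightarrow> complex"
  assumes sym: "\<And>i j. i < n \<Longrightarrow> j < n \<Longrightarrow> a i j = a j i"
    and "z \<in> \<real>"
    and t: "\<And>i. i < n \<Longrightarrow> t i = (\<Sum>j<n. of_real (a i j) * v j) - z * v i"
    and ev: "\<And>i. i < n \<Longrightarrow> (\<Sum>j<n. of_real (a i j) * t j) = z * t i"
    and "i < n"
  shows "t i = 0"
proof -
  have ev': "(\<Sum>j<n. of_real (a i j) * cnj (t j)) = z * cnj (t i)" if "i < n" for i
    using arg_cong[OF ev[OF that], of cnj] \<open>z \<in> \<real>\<close> by (simp add: Reals_cnj_iff)
  have "(\<Sum>i<n. cnj (t i) * t i) =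
      (\<Sum>i<n. cnj (t i) * (\<Sum>j<n. of_real (a i j) * v j)) - (\<Sum>i<n. cnj (t i) * (z * v i))"
    by (simp add: t right_diff_distrib sum_subtractf)
  also have "(\<Sum>i<n. cnj (t i) * (\<Sum>j<n. of_real (a i j) * v j)) =
      (\<Sum>i<n. v i * (\<Sum>j<n. of_real (a i j) * cnj (t j)))"
    using sym by (intro sum_symmetric_form) simp
  also have "\<dots> = (\<Sum>i<n. cnj (t i) * (z * v i))"
    by (simp add: ev') (simp add: mult_ac)
  finally show ?thesis
    using \<open>i < n\<close> by (simp add: sum_cnj_mult_eq_0_iff)
qed


text \<open>The real and imaginary parts of \<open>v\<close> satisfy the eigenvalue equation
  separately, and one of them is nonzero. This connects complex roots with \<open>psd_mat\<close>,
  which speaks of real eigenvectors.\<close>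

lemma real_eigenvalue_of_complex_eigenvector:
  fixes A :: "real mat" and v :: "nat \<Rightarrow> complex"
  assumes A: "A \<in> carrier_mat n n"
    and ev: "\<And>i. i < n \<Longrightarrow> (\<Sum>j<n. of_real (A $$ (i, j)) * v j) = of_real e * v i"
    and nz: "i < n" "v i \<noteq> 0"
  shows "eigenvalue A e"
proof -
  have eig: "eigenvalue A e"
    if w: "\<And>i. i < n \<Longrightarrow> (\<Sum>j<n. A $$ (i, j) * w j) = e * w i" and "w i \<noteq> 0" for w
  proof -
    have "vec n w \<noteq> 0\<^sub>v n"
      using that(2) nz(1) by (metis index_vec index_zero_vec(1))
    moreover have "A *\<^sub>v vec n w = e \<cdot>\<^sub>v vec n w"
      using A w by (intro eq_vecI) (auto simp: scalar_prod_def lessThan_atLeast0)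
    ultimately show ?thesis
      using A unfolding eigenvalue_def eigenvector_def by (intro exI[of _ "vec n w"]) auto
  qed
  have "(\<Sum>j<n. A $$ (i, j) * Re (v j)) = e * Re (v i)" if "i < n" for i
    using arg_cong[OF ev[OF that], of Re] by simp
  moreover have "(\<Sum>j<n. A $$ (i, j) * Im (v j)) = e * Im (v i)" if "i < n" for i
    using arg_cong[OF ev[OF that], of Im] by simp
  moreover have "Re (v i) \<noteq> 0 \<or> Im (v i) \<noteq> 0"
    using nz(2) by (simp add: complex_eq_iff)
  ultimately show ?thesis
    using eig[of "\<lambda>j. Re (v j)"] eig[of "\<lambda>j. Im (v j)"] by blast
qed

text \<open>Take an annihilating polynomial of least degree. Each cofactor of a root produces an
  eigenvector, so symmetry makes all roots real and simple, and semidefiniteness makes them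
  nonnegative.\<close>

lemma symmetric_orbit_exponential_sum:
  fixes A :: "real mat" and s :: "nat \<Rightarrow> nat \<Rightarrow> real"
  assumes A: "A \<in> carrier_mat n n" "psd_mat A"
    and orb: "orbit n (\<lambda>i j. A $$ (i, j)) s"
  obtains I :: "complex set" and b :: "complex \<Rightarrow> real" and c :: "nat \<Rightarrow> complex \<Rightarrow> real"
  where "finite I" "\<And>z. z \<in> I \<Longrightarrow> 0 \<le> b z"
    "\<And>i k. i < n \<Longrightarrow> s i k = (\<Sum>z\<in>I. c i z * b z ^ k)"
proof -
  \<comment> \<open>Over the complex numbers the annihilating polynomial splits into linear
    factors.\<close>
  define a :: "nat \<Rightarrow> nat \<Rightarrow> complex" where "a i j = of_real (A $$ (i, j))" for i j
  define S :: "nat \<Rightarrow> nat \<Rightarrow> complex" where "S i k = of_real (s i k)" for i k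
  have sym: "A $$ (i, j) = A $$ (j, i)" if "i < n" "j < n" for i j
    using A that unfolding psd_mat_def by (metis carrier_matD index_transpose_mat(1))
  have orbS: "orbit n a S"
    using orb unfolding orbit_def by (simp add: a_def S_def)
  define ann where "ann p \<longleftrightarrow> p \<noteq> 0 \<and> (\<forall>i<n. \<forall>k. shift_poly p (S i) k = 0)" for p
  have "\<exists>p. ann p"
    using orbit_annihilating_poly[OF orbS] unfolding ann_def by metis
  then obtain p where p: "ann p" and min: "\<And>q. ann q \<Longrightarrow> degree p \<le> degree q"
    using ex_has_least_nat[of ann _ degree] by blast
  have not_ann: "\<exists>i<n. \<exists>k. shift_poly q (S i) k \<noteq> 0" if "p = [:-z, 1:] * q" for z q
  proof (rule ccontr)
    assume "\<not> ?thesis"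
    moreover have "q \<noteq> 0" using p that unfolding ann_def by auto
    ultimately have "degree p \<le> degree q" by (intro min) (auto simp: ann_def)
    moreover have "degree p = degree [:-z, 1:] + degree q"
      unfolding that by (rule degree_mult_eq) (use \<open>q \<noteq> 0\<close> in auto)
    ultimately show False by simp
  qed
  \<comment> \<open>Applying A - z to the orbit filtered by \<open>q\<close> gives the orbit
    filtered by \<open>p\<close>, which is 0.\<close>
  have eigen: "(\<Sum>j<n. a i j * shift_poly q (S j) k) = z * shift_poly q (S i) k"
    if "p = [:-z, 1:] * q" "i < n" for z q i k
    using p that orbit_Suc[OF orbit_shift_poly[OF orbS], of i q k]
    unfolding ann_def that(1) shift_poly_root_factor by simp
  have root: "z \<in> \<real> \<and> 0 \<le> Re z" if pq: "p = [:-z, 1:] * q" for z q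
  proof -
    obtain i k where ik: "i < n" "shift_poly q (S i) k \<noteq> 0" using not_ann[OF pq] by blast
    have real: "z \<in> \<real>"
      by (rule real_symmetric_eigenvalue_real[where a = "\<lambda>i j. A $$ (i, j)"
            and v = "\<lambda>j. shift_poly q (S j) k", OF sym _ ik])
        (use eigen[OF pq] in \<open>simp_all add: a_def\<close>)
    then have z: "z = of_real (Re z)" by (simp add: of_real_Re)
    have "eigenvalue A (Re z)"
      by (rule real_eigenvalue_of_complex_eigenvector[where v = "\<lambda>j. shift_poly q (S j) k",
            OF A(1) _ ik])
        (use eigen[OF pq] z in \<open>simp add: a_def\<close>)
    then show ?thesis using A(2) real unfolding psd_mat_def by blast
  qed
  \<comment> \<open>At a double root the filtered vector is both an eigenvector for \<open>z\<close>
    and of the form (A - z)w, hence zero, against the minimal degree of \<open>p\<close>.\<close>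
  have simple: "poly q z \<noteq> 0" if pq: "p = [:-z, 1:] * q" for z q
  proof
    assume "poly q z = 0"
    then obtain r where r: "q = [:-z, 1:] * r" by (metis dvdE poly_eq_0_iff_dvd)
    obtain i k where ik: "i < n" "shift_poly q (S i) k \<noteq> 0" using not_ann[OF pq] by blast
    have "shift_poly q (S i) k = 0"
    proof (rule real_symmetric_no_nilpotent_part[where a = "\<lambda>i j. A $$ (i, j)"
          and t = "\<lambda>j. shift_poly q (S j) k" and v = "\<lambda>j. shift_poly r (S j) k", OF sym])
      show "z \<in> \<real>" using root[OF pq] ..
      show "shift_poly q (S j) k =
          (\<Sum>l<n. of_real (A $$ (j, l)) * shift_poly r (S l) k) - z * shift_poly r (S j) k"
        if "j < n" for j
        using orbit_Suc[OF orbit_shift_poly[OF orbS] that, of r k]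
        unfolding r shift_poly_root_factor by (simp add: a_def)
      show "(\<Sum>l<n. of_real (A $$ (j, l)) * shift_poly q (S l) k) = z * shift_poly q (S j) k"
        if "j < n" for j
        using eigen[OF pq that] by (simp add: a_def)
    qed (use ik in auto)
    with ik show False by simp
  qed
  have "\<exists>c. \<forall>k. S i k = (\<Sum>z | poly p z = 0. c z * z ^ k)" if "i < n" for i
    using p that by (intro annihilated_by_simple_roots simple) (auto simp: ann_def)
  then obtain c where
    c: "\<And>i k. i < n \<Longrightarrow> S i k = (\<Sum>z | poly p z = 0. c i z * z ^ k)"
    by metis
  have root': "z \<in> \<real> \<and> 0 \<le> Re z" if "poly p z = 0" for z
    using that root by (metis dvdE poly_eq_0_iff_dvd)
  have "s i k = (\<Sum>z | poly p z = 0. Re (c i z) * Re z ^ k)" if "i < n" for i k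
  proof -
    have "s i k = Re (S i k)" by (simp add: S_def)
    also have "\<dots> = (\<Sum>z | poly p z = 0. Re (c i z * z ^ k))" by (simp add: c that)
    also have "\<dots> = (\<Sum>z | poly p z = 0. Re (c i z) * Re z ^ k)"
    proof (rule sum.cong)
      fix z assume "z \<in> {z. poly p z = 0}"
      then have "z = of_real (Re z)" using root' by (simp add: of_real_Re)
      then have "z ^ k = of_real (Re z ^ k)" by (metis of_real_power)
      then show "Re (c i z * z ^ k) = Re (c i z) * Re z ^ k" by simp
    qed simp
    finally show ?thesis .
  qed
  moreover have "finite {z. poly p z = 0}" using p poly_roots_finite unfolding ann_def by blast
  ultimately show thesis
    using root' by (intro that[of "{z. poly p z = 0}" Re "\<lambda>i z. Re (c i z)"]) auto
qed

section \<open>Positive orbits of a nonnegative symmetric matrix\<close>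

text \<open>The cross difference is the numerator in comparing \<open>f (Suc k) / f k\<close> with
  \<open>g (Suc k) / g k\<close>. It is again an exponential sum, indexed by pairs with bases
  \<open>b z * b y\<close>.\<close>

lemma exponential_sums_cross_difference_signed:
  fixes b c d :: "'i \<Rightarrow> real"
  assumes "finite I" "\<And>z. z \<in> I \<Longrightarrow> 0 \<le> b z"
    and f: "\<And>k. f k = (\<Sum>z\<in>I. c z * b z ^ k)" and g: "\<And>k. g k = (\<Sum>z\<in>I. d z * b z ^ k)"
  shows "(\<forall>\<^sub>F k in sequentially. g (Suc k) * f k \<le> f (Suc k) * g k) \<or>
    (\<forall>\<^sub>F k in sequentially. f (Suc k) * g k \<le> g (Suc k) * f k)"
proof -
  have prod: "f (Suc k) * g k - g (Suc k) * f k =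
      (\<Sum>(z, y)\<in>I \<times> I. (c z * d y * (b z - b y)) * (b z * b y) ^ k)" for k
  proof -
    have "g (Suc k) * f k = (\<Sum>z\<in>I. \<Sum>y\<in>I. (c z * b z ^ k) * (d y * b y ^ Suc k))"
      unfolding f g by (subst mult.commute) (rule sum_product)
    moreover have "f (Suc k) * g k = (\<Sum>z\<in>I. \<Sum>y\<in>I. (c z * b z ^ Suc k) * (d y * b y ^ k))"
      unfolding f g by (rule sum_product)
    ultimately have "f (Suc k) * g k - g (Suc k) * f k =
       (\<Sum>z\<in>I. \<Sum>y\<in>I. (c z * d y * (b z - b y)) * (b z * b y) ^ k)"
      by (simp add: algebra_simps power_mult_distrib flip: sum_subtractf)
    then show ?thesis by (simp add: sum.cartesian_product)
  qed
  have "(\<forall>\<^sub>F k in sequentially. 0 \<le> f (Suc k) * g k - g (Suc k) * f k) \<or>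
      (\<forall>\<^sub>F k in sequentially. f (Suc k) * g k - g (Suc k) * f k \<le> 0)"
    unfolding prod case_prod_unfold
    by (rule exponential_sum_eventually_signed) (use assms in auto)
  then show ?thesis by simp
qed

text \<open>If row \<open>i\<close> has a positive entry \<open>a i j\<close> then \<open>a j i > 0\<close> too, and returning through \<open>j\<close>
  propagates positivity by two steps.\<close>

lemma symmetric_orbit_positive_or_zero:
  fixes a s :: "nat \<Rightarrow> nat \<Rightarrow> real"
  assumes orb: "orbit n a s"
    and sym: "\<And>i j. i < n \<Longrightarrow> j < n \<Longrightarrow> a i j = a j i"
    and nn: "\<And>i j. i < n \<Longrightarrow> j < n \<Longrightarrow> 0 \<le> a i j"
    and pos: "\<And>i. i < n \<Longrightarrow> 0 < s i 0"
    and i: "i < n"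
  shows "(\<forall>k. 0 < s i k) \<or> (\<forall>k. s i (Suc k) = 0)"
proof (cases "\<forall>j<n. a i j = 0")
  case True
  then show ?thesis using orbit_Suc[OF orb i] by simp
next
  case False
  then obtain j where j: "j < n" "0 < a i j" using nn[OF i] by (metis less_eq_real_def)
  have nonneg: "0 \<le> s i k" if "i < n" for i k
    using that
  proof (induction k arbitrary: i)
    case 0
    then show ?case using pos by (simp add: less_imp_le)
  next
    case (Suc k)
    then show ?case
      by (auto simp: orbit_Suc[OF orb] intro!: sum_nonneg mult_nonneg_nonneg nn)
  qed
  have step: "a i' j' * s j' k \<le> s i' (Suc k)" if "i' < n" "j' < n" for i' j' k
    unfolding orbit_Suc[OF orb that(1)]
    by (rule member_le_sum) (use that nn nonneg in auto)
  \<comment> \<open>Two consecutive values are carried along because the return from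
    \<open>i\<close> through \<open>j\<close> takes two steps.\<close>
  have "0 < s i k \<and> 0 < s i (Suc k)" for k
  proof (induction k)
    case 0
    have "0 < a i j * s j 0" using j pos by simp
    then show ?case using step[OF i j(1), of 0] pos[OF i] by linarith
  next
    case (Suc k)
    have "0 < a j i * s i k" using Suc j sym[OF i j(1)] by simp
    then have "0 < s j (Suc k)" using step[OF j(1) i, of k] by linarith
    then have "0 < a i j * s j (Suc k)" using j by simp
    then show ?case using step[OF i j(1), of "Suc k"] Suc by linarith
  qed
  then show ?thesis by blast
qed

text \<open>A nonnegative row preserves entrywise inequalities between A^(k+1) x and m A^k x. With
  \<open>m\<close> the extremal ratio, attained at \<open>i\<close>, the conclusion is the desired
  inequality at \<open>i\<close>.\<close>

lemma orbit_ratio_bound_step: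
  fixes a s :: "nat \<Rightarrow> nat \<Rightarrow> real"
  assumes orb: "orbit n a s" and i: "i < n"
    and nn: "\<And>j. j < n \<Longrightarrow> 0 \<le> a i j"
  shows "(\<And>j. j < n \<Longrightarrow> s j (Suc k) \<le> m * s j k) \<Longrightarrow> s i (Suc (Suc k)) \<le> m * s i (Suc k)"
    and "(\<And>j. j < n \<Longrightarrow> m * s j k \<le> s j (Suc k)) \<Longrightarrow> m * s i (Suc k) \<le> s i (Suc (Suc k))"
proof -
  have m: "m * s i (Suc k) = (\<Sum>j<n. a i j * (m * s j k))"
    unfolding orbit_Suc[OF orb i] by (simp add: sum_distrib_left mult_ac)
  show "s i (Suc (Suc k)) \<le> m * s i (Suc k)" if "\<And>j. j < n \<Longrightarrow> s j (Suc k) \<le> m * s j k"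
    unfolding m orbit_Suc[OF orb i, of "Suc k"]
    using that nn by (intro sum_mono mult_left_mono) auto
  show "m * s i (Suc k) \<le> s i (Suc (Suc k))" if "\<And>j. j < n \<Longrightarrow> m * s j k \<le> s j (Suc k)"
    unfolding m orbit_Suc[OF orb i, of "Suc k"]
    using that nn by (intro sum_mono mult_left_mono) auto
qed

text \<open>Eventual comparison is a total preorder, so a finite index set has a greatest element;
  finiteness also gives one threshold for all comparisons.\<close>

lemma eventually_comparable_has_maximum:
  fixes r :: "'i \<Rightarrow> nat \<Rightarrow> real"
  assumes "finite I" "I \<noteq> {}"
    and "\<And>i j. i \<in> I \<Longrightarrow> j \<in> I \<Longrightarrow>
      (\<forall>\<^sub>F k in sequentially. r i k \<le> r j k) \<or> (\<forall>\<^sub>F k in sequentially. r j k \<le> r i k)"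
  shows "\<exists>i\<in>I. \<forall>\<^sub>F k in sequentially. \<forall>j\<in>I. r j k \<le> r i k"
  using assms
proof (induction I rule: finite_ne_induct)
  case (insert x I)
  have "\<exists>i\<in>I. \<forall>\<^sub>F k in sequentially. \<forall>j\<in>I. r j k \<le> r i k"
    by (rule insert.IH) (simp add: insert.prems)
  then obtain i where i: "i \<in> I" "\<forall>\<^sub>F k in sequentially. \<forall>j\<in>I. r j k \<le> r i k" ..
  have "(\<forall>\<^sub>F k in sequentially. r x k \<le> r i k) \<or> (\<forall>\<^sub>F k in sequentially. r i k \<le> r x k)"
    using insert.prems i(1) by blast
  then show ?case
  proof
    assume "\<forall>\<^sub>F k in sequentially. r x k \<le> r i k"
    with i(2) have "\<forall>\<^sub>F k in sequentially. \<forall>j\<in>insert x I. r j k \<le> r i k"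
      by eventually_elim simp
    with i(1) show ?thesis by blast
  next
    assume "\<forall>\<^sub>F k in sequentially. r i k \<le> r x k"
    with i(2) have "\<forall>\<^sub>F k in sequentially. \<forall>j\<in>insert x I. r j k \<le> r x k"
      by eventually_elim force
    then show ?thesis by blast
  qed
qed simp

lemma orbit_pow_mat:
  assumes A: "A \<in> carrier_mat n n" and x: "x \<in> carrier_vec n"
  shows "orbit n (\<lambda>i j. A $$ (i, j)) (\<lambda>i k. (A ^\<^sub>m k *\<^sub>v x) $ i)"
  unfolding orbit_def
proof (intro allI impI)
  fix i k assume i: "i < n"
  have Ak: "A ^\<^sub>m k \<in> carrier_mat n n" for k using A by simp
  \<comment> \<open>Matrix powers append the new factor on the right, whereas the orbit recurrence
    needs it on the left.\<close>
  have comm: "A ^\<^sub>m k * A = A * A ^\<^sub>m k" for k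
  proof (induction k)
    case (Suc k)
    have "A ^\<^sub>m Suc k * A = (A * A ^\<^sub>m k) * A" using Suc by simp
    also have "\<dots> = A * (A ^\<^sub>m k * A)" by (rule assoc_mult_mat[OF A Ak A])
    finally show ?case by simp
  qed (use A in simp)
  have "A ^\<^sub>m Suc k *\<^sub>v x = A *\<^sub>v (A ^\<^sub>m k *\<^sub>v x)"
    using assoc_mult_mat_vec[OF A Ak x] comm by simp
  then show "(A ^\<^sub>m Suc k *\<^sub>v x) $ i = (\<Sum>j<n. A $$ (i, j) * (A ^\<^sub>m k *\<^sub>v x) $ j)"
    using A Ak[of k] i by (simp add: scalar_prod_def lessThan_atLeast0 del: pow_mat.simps)
qed

theorem theorem2p5:
  fixes n :: nat and A :: "real mat" and x :: "real vec"
  assumes "n \<ge> 1"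
    and "A \<in> carrier_mat n n"
    and "irreducible_mat A"
    and "nonneg_mat A"
    and "psd_mat A"
    and "x \<in> carrier_vec n"
    and "pos_vec x"
  shows "(\<exists>i1. log_concavity_index A x i1) \<and>
    (\<exists>i2. log_convexity_index A x i2) \<and>
    (\<forall>i1 i2. log_concavity_index A x i1 \<longrightarrow> log_convexity_index A x i2 \<longrightarrow>
      (\<exists>k1\<ge>1. log_concave_from k1 (\<lambda>k. ((A ^\<^sub>m (k - 1)) *\<^sub>v x) $ i1)) \<and>
      (\<exists>k2\<ge>1. log_convex_from k2 (\<lambda>k. ((A ^\<^sub>m (k - 1)) *\<^sub>v x) $ i2)))"
proof -
  define s where "s = (\<lambda>i k. (A ^\<^sub>m k *\<^sub>v x) $ i)"
  define a where "a = (\<lambda>i j. A $$ (i, j))"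
  define r where "r i k = growth_ratio A x k i" for i k
  have dim: "dim_row A = n" using assms(2) by simp
  have rs: "r i (Suc k) = s i (Suc k) / s i k" for i k
    by (simp add: r_def s_def growth_ratio_def)
  have orb: "orbit n a s"
    using orbit_pow_mat[OF assms(2,6)] unfolding s_def a_def .
  have sym: "a i j = a j i" if "i < n" "j < n" for i j
    using assms(2,5) that unfolding psd_mat_def a_def
    by (metis carrier_matD index_transpose_mat(1))
  have nn: "0 \<le> a i j" if "i < n" "j < n" for i j
    using assms(2,4) that unfolding nonneg_mat_def a_def by auto
  have pos: "0 < s i 0" if "i < n" for i
    using assms(2,6,7) that unfolding s_def pos_vec_def by auto
  have dich: "(\<forall>k. 0 < s i k) \<or> (\<forall>k. s i (Suc k) = 0)" if "i < n" for i
    using symmetric_orbit_positive_or_zero[OF orb sym nn pos that] .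
  have nonneg: "0 \<le> s i k" if "i < n" for i k
    using dich[OF that] pos[OF that] by (cases k) (auto intro: less_imp_le)
  have vanish: "s i (Suc k) = 0" if "i < n" "s i k = 0" for i k
    using dich[OF that(1)] that(2) by (metis less_irrefl)
  obtain I :: "complex set" and b c where I: "finite I" "\<And>z. z \<in> I \<Longrightarrow> 0 \<le> b z"
    and sc: "\<And>i k. i < n \<Longrightarrow> s i k = (\<Sum>z\<in>I. c i z * b z ^ k)"
    by (rule symmetric_orbit_exponential_sum[OF assms(2,5) orb[unfolded a_def]])
      (rule that, auto)

  \<comment> \<open>Eventual comparability of the growth ratios\<close>
  have compare: "(\<forall>\<^sub>F k in sequentially. r i k \<le> r j k) \<or> (\<forall>\<^sub>F k in sequentially. r j k \<le> r i k)"
    if "i < n" "j < n" for i j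
  proof -
    have "(\<forall>\<^sub>F k in sequentially. r i (Suc k) \<le> r j (Suc k)) \<or>
        (\<forall>\<^sub>F k in sequentially. r j (Suc k) \<le> r i (Suc k))"
    proof (cases "(\<forall>k. 0 < s i k) \<and> (\<forall>k. 0 < s j k)")
      case True
      then have "r i (Suc k) \<le> r j (Suc k) \<longleftrightarrow> s i (Suc k) * s j k \<le> s j (Suc k) * s i k"
        "r j (Suc k) \<le> r i (Suc k) \<longleftrightarrow> s j (Suc k) * s i k \<le> s i (Suc k) * s j k" for k
        by (simp_all add: rs frac_le_eq divide_le_0_iff pos_divide_le_eq pos_le_divide_eq field_simps)
      then show ?thesis
        using exponential_sums_cross_difference_signed[OF I sc[OF that(1)] sc[OF that(2)]] by auto
    next
      \<comment> \<open>One of the two coordinates vanishes from time 1 on, so its ratio is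
        constantly 0 and lies below the other, nonnegative ratio.\<close>
      case False
      then have "(\<forall>k. r i (Suc k) = 0) \<or> (\<forall>k. r j (Suc k) = 0)"
        using dich that by (auto simp: rs)
      moreover have "0 \<le> r i (Suc k)" "0 \<le> r j (Suc k)" for k
        using nonneg that by (auto simp: rs)
      ultimately show ?thesis by auto
    qed
    then show ?thesis
      using eventually_sequentially_Suc[of "\<lambda>k. r i k \<le> r j k"]
        eventually_sequentially_Suc[of "\<lambda>k. r j k \<le> r i k"] by blast
  qed
  have ne: "{..<n} \<noteq> {}" using assms(1) by (simp add: lessThan_empty_iff)

  \<comment> \<open>Existence of the extremal indices\<close>
  have "\<exists>i1. log_concavity_index A x i1"
  proof -
    have "\<exists>i\<in>{..<n}. \<forall>\<^sub>F k in sequentially. \<forall>j\<in>{..<n}. r j k \<le> r i k"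
      using ne compare by (intro eventually_comparable_has_maximum) auto
    then obtain i K where i: "i < n" and K: "\<And>k j. k \<ge> K \<Longrightarrow> j < n \<Longrightarrow> r j k \<le> r i k"
      unfolding eventually_sequentially by auto
    \<comment> \<open>The threshold is \<open>Suc K\<close> because the index definition asks for a
      positive one.\<close>
    have "r i k = Max ((\<lambda>i. r i k) ` {..<n})" if "k \<ge> Suc K" for k
      using i K that by (intro Max_eqI[symmetric]) auto
    then show ?thesis
      using i unfolding log_concavity_index_def dim r_def by blast
  qed
  moreover have "\<exists>i2. log_convexity_index A x i2"
  proof -
    \<comment> \<open>Negating the ratios turns the minimum into a maximum.\<close>
    have "\<exists>i\<in>{..<n}. \<forall>\<^sub>F k in sequentially. \<forall>j\<in>{..<n}. - r j k \<le> - r i k"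
      using ne compare by (intro eventually_comparable_has_maximum) auto
    then obtain i K where i: "i < n" and K: "\<And>k j. k \<ge> K \<Longrightarrow> j < n \<Longrightarrow> r i k \<le> r j k"
      unfolding eventually_sequentially by auto
    have "r i k = Min ((\<lambda>i. r i k) ` {..<n})" if "k \<ge> Suc K" for k
      using i K that by (intro Min_eqI[symmetric]) auto
    then show ?thesis
      using i unfolding log_convexity_index_def dim r_def by blast
  qed

  \<comment> \<open>Log-concavity and log-convexity at the extremal indices\<close>
  moreover have "\<exists>k1\<ge>1. log_concave_from k1 (\<lambda>k. ((A ^\<^sub>m (k - 1)) *\<^sub>v x) $ i)"
    if index: "log_concavity_index A x i" for i
  proof -
    obtain K where i: "i < n" and K: "\<And>k. k \<ge> K \<Longrightarrow> r i k = Max ((\<lambda>i. r i k) ` {..<n})"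
      using index unfolding log_concavity_index_def dim r_def by blast
    have conc: "s i k * s i (Suc (Suc k)) \<le> (s i (Suc k))\<^sup>2" if "k \<ge> K" for k
    proof (cases "s i k = 0")
      case False
      \<comment> \<open>The maximal ratio bounds every coordinate; a coordinate that is 0 at time
        \<open>k\<close> stays 0.\<close>
      have "s j (Suc k) \<le> r i (Suc k) * s j k" if "j < n" for j
      proof (cases "s j k = 0")
        case False
        then have "0 < s j k" using nonneg[OF that, of k] by simp
        moreover have "r j (Suc k) \<le> r i (Suc k)"
          using K[of "Suc k"] \<open>k \<ge> K\<close> that by simp
        ultimately show ?thesis unfolding rs[of j] by (simp add: pos_divide_le_eq)
      qed (use vanish[OF that] in simp)
      then have "s i (Suc (Suc k)) \<le> r i (Suc k) * s i (Suc k)"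
        using nn i by (intro orbit_ratio_bound_step(1)[OF orb i]) auto
      then have "s i k * s i (Suc (Suc k)) \<le> s i k * (r i (Suc k) * s i (Suc k))"
        using nonneg[OF i] by (rule mult_left_mono)
      then show ?thesis using False by (simp add: rs power2_eq_square)
    qed simp
    \<comment> \<open>The sequence at \<open>m\<close> is \<open>s i (m - 1)\<close>, so an interior
      index \<open>m = k + 2\<close> involves the times \<open>k\<close>, \<open>k + 1\<close>,
      \<open>k + 2\<close>, and \<open>m > Suc K\<close> means \<open>k \<ge> K\<close>.\<close>
    have "log_concave_from (Suc K) (\<lambda>k. ((A ^\<^sub>m (k - 1)) *\<^sub>v x) $ i)"
      unfolding log_concave_from_def
    proof (intro allI impI)
      fix m assume "m > Suc K"
      then have "m = Suc (Suc (m - 2))" "K \<le> m - 2" by simp_all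
      then obtain k where k: "m = Suc (Suc k)" "K \<le> k" by metis
      show "((A ^\<^sub>m (m - 1 - 1)) *\<^sub>v x) $ i * ((A ^\<^sub>m (m + 1 - 1)) *\<^sub>v x) $ i
          \<le> (((A ^\<^sub>m (m - 1)) *\<^sub>v x) $ i)\<^sup>2"
        using conc[OF k(2)] by (simp add: k(1) s_def del: pow_mat.simps)
    qed
    then show ?thesis by (intro exI[of _ "Suc K"]) simp
  qed
  moreover have "\<exists>k2\<ge>1. log_convex_from k2 (\<lambda>k. ((A ^\<^sub>m (k - 1)) *\<^sub>v x) $ i)"
    if index: "log_convexity_index A x i" for i
  proof -
    obtain K where i: "i < n" and K: "\<And>k. k \<ge> K \<Longrightarrow> r i k = Min ((\<lambda>i. r i k) ` {..<n})"
      using index unfolding log_convexity_index_def dim r_def by blast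
    have conv: "(s i (Suc k))\<^sup>2 \<le> s i k * s i (Suc (Suc k))" if "k \<ge> K" for k
    \<comment> \<open>For \<open>s i k = 0\<close> the right side is 0, so the left side must vanish
      as well, which \<open>vanish\<close> provides.\<close>
    proof (cases "s i k = 0")
      case False
      have "r i (Suc k) * s j k \<le> s j (Suc k)" if "j < n" for j
      proof (cases "s j k = 0")
        case False
        then have "0 < s j k" using nonneg[OF that, of k] by simp
        moreover have "r i (Suc k) \<le> r j (Suc k)"
          using K[of "Suc k"] \<open>k \<ge> K\<close> that by simp
        ultimately show ?thesis unfolding rs[of j] by (simp add: pos_le_divide_eq)
      qed (use nonneg[OF that] in simp)
      then have "r i (Suc k) * s i (Suc k) \<le> s i (Suc (Suc k))"
        using nn i by (intro orbit_ratio_bound_step(2)[OF orb i]) auto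
      then have "s i k * (r i (Suc k) * s i (Suc k)) \<le> s i k * s i (Suc (Suc k))"
        using nonneg[OF i] by (rule mult_left_mono)
      then show ?thesis using False by (simp add: rs power2_eq_square)
    qed (use vanish[OF i] in simp)
    have "log_convex_from (Suc K) (\<lambda>k. ((A ^\<^sub>m (k - 1)) *\<^sub>v x) $ i)"
      unfolding log_convex_from_def
    proof (intro allI impI)
      fix m assume "m > Suc K"
      then have "m = Suc (Suc (m - 2))" "K \<le> m - 2" by simp_all
      then obtain k where k: "m = Suc (Suc k)" "K \<le> k" by metis
      show "((A ^\<^sub>m (m - 1 - 1)) *\<^sub>v x) $ i * ((A ^\<^sub>m (m + 1 - 1)) *\<^sub>v x) $ i
          \<ge> (((A ^\<^sub>m (m - 1)) *\<^sub>v x) $ i)\<^sup>2"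
        using conv[OF k(2)] by (simp add: k(1) s_def del: pow_mat.simps)
    qed
    then show ?thesis by (intro exI[of _ "Suc K"]) simp
  qed
  ultimately show ?thesis by blast
qed

end
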